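(* Let $n \geq 1$ be an integer and let $A \subseteq \mathbb{F}_3^n$ be a cap set of size $|A| = c^n$, where $c \geq 0$ is a real number. Then there exist an integer $m > n$ and a cap set $B \subseteq \mathbb{F}_3^m$ such that $|B| > c^m$.
   Context: $\mathbb{F}_3$ is the field with three elements. A cap set in $\mathbb{F}_3^N$ is a set $S \subseteq \mathbb{F}_3^N$ with no solutions to $x+y+z=0$ with $x,y,z\in S$, other than the trivial solutions $x=y=z$. *)

theory Defs
  imports Complex_Main "HOL-Library.Numeral_Type" "Jordan_Normal_Form.Matrix"
begin

text \<open>The numeral type \<open>3\<close> carries arithmetic modulo 3.  The library provides it as a
  commutative ring only; the following lemma shows that it is the field with three elements.\<close>

type_synonym F3 = 3

lemma F3_field: "CARD(F3) = 3" "\<And>x :: F3. x \<noteq> 0 \<Longrightarrow> \<exists>y. x * y = 1"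
proof -
  show "CARD(F3) = 3" by simp
  show "\<exists>y. x * y = 1" if "x \<noteq> 0" for x :: F3
  proof -
    have "x = 0 \<or> x = 1 \<or> x = 2"
    proof (cases x)
      case (of_int z)
      then have "z = 0 \<or> z = 1 \<or> z = 2" by auto
      then show ?thesis using of_int by auto
    qed
    moreover have "(2 :: F3) * 2 = 1" by simp
    ultimately show ?thesis using that by (metis mult_1)
  qed
qed

definition cap_set :: "nat \<Rightarrow> F3 vec set \<Rightarrow> bool" where
  "cap_set N S \<longleftrightarrow> S \<subseteq> carrier_vec N \<and>
     (\<forall>x\<in>S. \<forall>y\<in>S. \<forall>z\<in>S. x + y + z = 0\<^sub>v N \<longrightarrow> x = y \<and> y = z)"

end

theory Submission
  imports Defs "HOL-Library.FuncSet"
begin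

text \<open>
  The product construction turns a cap set \<open>A\<close> with \<open>a\<close> elements into cap sets with \<open>a ^ M\<close>
  elements in \<open>n * M\<close> dimensions, so it suffices to beat \<open>a ^ M\<close> for some \<open>M\<close>.  For this, choose a
  point \<open>p\<close> outside \<open>A\<close> and consider the words of length \<open>M\<close> over \<open>A \<union> {p}\<close> with exactly one letter
  \<open>p\<close> (the hole).  There are \<open>M * a ^ (M - 1)\<close> of them, which exceeds \<open>a ^ M\<close> by the factor \<open>M / a\<close>,
  but they do not form a cap set.  The task is to thin them out by a factor smaller than \<open>M / a\<close>.

  Consider words \<open>f\<close>, \<open>g\<close>, \<open>h\<close> with one hole each and with zero sum in every position.  A position
  without a hole forces equal letters, as \<open>A\<close> is a cap set.  A position with exactly two holes is
  impossible, as \<open>p + p + w = 0\<close> means \<open>w = p\<close>.  Hence either the three holes coincide and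
  \<open>f = g = h\<close>, or the holes lie at three distinct positions \<open>i\<close>, \<open>j\<close>, \<open>k\<close> and the words agree
  everywhere else.  To exclude the second case, let \<open>\<phi>\<close> be an \<open>F3\<close>-valued function that vanishes at
  \<open>p\<close> only and is odd about \<open>p\<close>, and hash a word linearly to the vector
  \<open>\<Sum>l. \<phi> (f l) * weight l\<close>.  The hashes of a zero-sum triple have zero sum.  Keep only the words for
  which no coordinate of the hash takes a certain forbidden value: in each coordinate two values
  remain, and a zero-sum triple of these is constant.  So the hashes of \<open>f\<close> and \<open>g\<close> agree, which is a
  linear dependency, with nonzero coefficients, between the weights of \<open>i\<close>, \<open>j\<close> and \<open>k\<close>.  The weight
  of a position consists of its binary digits followed by a \<open>1\<close>, and no such dependency exists
  (\<open>weight_independent\<close>); this gives \<open>zero_sum_words_collapse\<close>.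

  With \<open>M = 2 ^ d\<close> positions the hash has \<open>d + 1\<close> coordinates.  For the best forbidden values at
  least the proportion \<open>(2 / 3) ^ (d + 1)\<close> of the words is kept (\<open>popular_shift\<close>).  This leaves
  \<open>2 ^ d * (2 / 3) ^ (d + 1) * a ^ (M - 1)\<close> words, and this exceeds \<open>a ^ M\<close> for large \<open>d\<close> because
  \<open>(4 / 3) ^ d\<close> is unbounded.
\<close>

section \<open>Arithmetic in the field with three elements\<close>

lemma F3_cases:
  fixes x :: F3
  obtains "x = 0" | "x = 1" | "x = 2"
proof (cases x)
  case (of_int z)
  then have "z = 0 \<or> z = 1 \<or> z = 2" by auto
  then show ?thesis using of_int that by auto
qed

text \<open>Any two elements of the field form a one-dimensional cap set.\<close>

lemma F3_sum_zero_avoiding: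
  fixes x y z s :: F3
  assumes "x + y + z = 0" "x \<noteq> s" "y \<noteq> s" "z \<noteq> s"
  shows "x = y" "y = z"
  using assms by (cases x rule: F3_cases; cases y rule: F3_cases; cases z rule: F3_cases;
      cases s rule: F3_cases; simp)+

lemma F3_sum_zero_nonzero:
  fixes x y z :: F3
  assumes "x + y + z = 0" "x \<noteq> 0" "y \<noteq> 0" "z \<noteq> 0"
  shows "x = y" "y = z"
  using F3_sum_zero_avoiding[OF assms] by auto

lemma F3_three_times: "(x :: F3) + x + x = 0"
  by (cases x rule: F3_cases) simp_all

lemma F3_mult_eq_0_iff: "(x :: F3) * y = 0 \<longleftrightarrow> x = 0 \<or> y = 0"
  by (cases x rule: F3_cases; cases y rule: F3_cases; simp)

lemma F3_of_bool_sum_zero: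
  assumes "of_bool P + of_bool Q + of_bool R = (0 :: F3)"
  shows "P = Q"
  using assms by (cases P; cases Q; cases R; simp)

section \<open>Points outside a cap set\<close>

lemma cap_set_misses_point:
  assumes "n \<ge> 1" "cap_set n A"
  obtains p where "p \<in> carrier_vec n" "p \<notin> A"
proof -
  have "\<not> carrier_vec n \<subseteq> A"
  proof
    assume *: "carrier_vec n \<subseteq> A"
    let ?v = "\<lambda>a :: F3. vec n (\<lambda>_. a)"
    have "?v 0 + ?v 1 + ?v 2 = 0\<^sub>v n"
      by (rule eq_vecI) auto
    moreover have "?v a \<in> A" for a
      using * by auto
    ultimately have "?v 0 = ?v 1"
      using assms(2) unfolding cap_set_def by blast
    then have "?v 0 $ 0 = ?v 1 $ 0"
      by simp
    then show False
      using assms(1) by simp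
  qed
  then show ?thesis
    using that by blast
qed

text \<open>The value of the function at \<open>u\<close> is the first nonzero coordinate of \<open>u - p\<close>, if any.  In characteristic
  three, \<open>p + u + v = 0\<close> says that \<open>u - p\<close> and \<open>v - p\<close> are negatives of each other.\<close>

lemma odd_function_around_point:
  fixes p :: "F3 vec"
  assumes p: "p \<in> carrier_vec n"
  obtains \<phi> :: "F3 vec \<Rightarrow> F3"
  where "\<phi> p = 0" "\<And>u. u \<in> carrier_vec n \<Longrightarrow> u \<noteq> p \<Longrightarrow> \<phi> u \<noteq> 0"
    "\<And>u v. u \<in> carrier_vec n \<Longrightarrow> v \<in> carrier_vec n \<Longrightarrow> p + u + v = 0\<^sub>v n \<Longrightarrow> \<phi> v = - \<phi> u"
proof -
  define D where "D u = (\<lambda>i. i < n \<and> u $ i \<noteq> p $ i)" for u :: "F3 vec"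
  define \<phi> where "\<phi> u = (if u = p then 0 else u $ (LEAST i. D u i) - p $ (LEAST i. D u i))" for u
  have least: "D u (LEAST i. D u i)" if "u \<in> carrier_vec n" "u \<noteq> p" for u
  proof -
    have "\<exists>i. D u i"
    proof (rule ccontr)
      assume "\<nexists>i. D u i"
      then have "u = p"
        using that p by (intro eq_vecI) (auto simp: D_def)
      then show False using that by simp
    qed
    then show ?thesis by (rule LeastI_ex)
  qed
  show ?thesis
  proof
    show "\<phi> p = 0"
      by (simp add: \<phi>_def)
    show "\<phi> u \<noteq> 0" if "u \<in> carrier_vec n" "u \<noteq> p" for u
      using least[OF that] that by (simp add: \<phi>_def D_def)
    show "\<phi> v = - \<phi> u" if u: "u \<in> carrier_vec n" and v: "v \<in> carrier_vec n"
      and sum: "p + u + v = 0\<^sub>v n" for u v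
    proof -
      have neg: "v $ i - p $ i = - (u $ i - p $ i)" if "i < n" for i
      proof -
        have "(p + u + v) $ i = 0"
          using sum that by simp
        then have "p $ i + u $ i + v $ i = 0"
          using that u v p by (simp add: add.assoc)
        moreover have "p $ i + p $ i + p $ i = 0"
          by (rule F3_three_times)
        ultimately show ?thesis
          by (cases "p $ i" rule: F3_cases; cases "u $ i" rule: F3_cases;
              cases "v $ i" rule: F3_cases; simp)
      qed
      have D_eq: "D u = D v"
        using neg by (fastforce simp: D_def fun_eq_iff)
      have eq: "u = p \<longleftrightarrow> v = p"
      proof -
        have "u = p \<longleftrightarrow> (\<forall>i. \<not> D u i)" "v = p \<longleftrightarrow> (\<forall>i. \<not> D v i)"
          using least u v by (auto simp: D_def)
        then show ?thesis
          using D_eq by simp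
      qed
      show ?thesis
      proof (cases "u = p")
        case True
        then show ?thesis using eq by (simp add: \<phi>_def)
      next
        case False
        then have "(LEAST i. D u i) < n"
          using least[OF u] by (simp add: D_def)
        then show ?thesis
          using False eq neg D_eq by (simp add: \<phi>_def)
      qed
    qed
  qed
qed

lemma zero_sum_pair:
  fixes p w :: "F3 vec"
  assumes "p \<in> carrier_vec n" "w \<in> carrier_vec n" "p + p + w = 0\<^sub>v n"
  shows "w = p"
proof (rule eq_vecI)
  show "dim_vec w = dim_vec p" using assms by auto
  fix e assume "e < dim_vec p"
  then have e: "e < n" using assms by simp
  have "(p + p + w) $ e = 0"
    using assms(3) e by simp
  then have "p $ e + p $ e + w $ e = 0"
    using e assms(1,2) by (simp add: add.assoc)
  then show "w $ e = p $ e"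
    by (cases "p $ e" rule: F3_cases; cases "w $ e" rule: F3_cases; simp)
qed

section \<open>Words over vectors as long vectors\<close>

text \<open>Concatenation of the \<open>M\<close> letters of a word, each a vector of dimension \<open>n\<close>, into one vector of
  dimension \<open>n * M\<close>.\<close>

definition glue :: "nat \<Rightarrow> nat \<Rightarrow> (nat \<Rightarrow> 'a vec) \<Rightarrow> 'a vec" where
  "glue n M f = vec (n * M) (\<lambda>k. f (k div n) $ (k mod n))"

lemma glue_index:
  assumes "i < n" "l < M"
  shows "l * n + i < n * M" "glue n M f $ (l * n + i) = f l $ i"
proof -
  have "l * n + i < l * n + n"
    using assms by simp
  also have "\<dots> = n * Suc l"
    by simp
  also have "\<dots> \<le> n * M"
    using assms by (intro mult_le_mono2) simp
  finally show "l * n + i < n * M" .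
  then show "glue n M f $ (l * n + i) = f l $ i"
    using assms by (simp add: glue_def)
qed

lemma inj_on_glue: "inj_on (glue n M) (PiE {..<M} (\<lambda>_. carrier_vec n))"
proof (rule inj_onI)
  fix f g :: "nat \<Rightarrow> 'a vec"
  assume f: "f \<in> PiE {..<M} (\<lambda>_. carrier_vec n)" and g: "g \<in> PiE {..<M} (\<lambda>_. carrier_vec n)"
    and eq: "glue n M f = glue n M g"
  show "f = g"
  proof (rule PiE_ext[OF f g])
    fix l assume l: "l \<in> {..<M}"
    show "f l = g l"
    proof (rule eq_vecI)
      have dims: "f l \<in> carrier_vec n" "g l \<in> carrier_vec n"
        using f g l by auto
      then show "dim_vec (f l) = dim_vec (g l)" by auto
      fix i assume "i < dim_vec (g l)"
      then have "i < n" using dims by auto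
      then show "f l $ i = g l $ i"
        using eq glue_index(2)[of i n l M f] glue_index(2)[of i n l M g] l by simp
    qed
  qed
qed

text \<open>The hypothesis only asks for \<open>f = g\<close>; the equality \<open>g = h\<close> follows by rotating the triple.\<close>

lemma cap_set_glue:
  assumes X: "X \<subseteq> PiE {..<M} (\<lambda>_. carrier_vec n)"
    and cap: "\<And>f g h. f \<in> X \<Longrightarrow> g \<in> X \<Longrightarrow> h \<in> X \<Longrightarrow>
      (\<And>l. l < M \<Longrightarrow> f l + g l + h l = 0\<^sub>v n) \<Longrightarrow> f = g"
  shows "cap_set (n * M) (glue n M ` X)"
proof -
  have collapse: "f = g \<and> g = h" if fgh: "f \<in> X" "g \<in> X" "h \<in> X"
    and sum: "glue n M f + glue n M g + glue n M h = 0\<^sub>v (n * M)" for f g h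
  proof -
    have block: "f l + g l + h l = 0\<^sub>v n" if l: "l < M" for l
    proof (rule eq_vecI)
      have dims: "f l \<in> carrier_vec n" "g l \<in> carrier_vec n" "h l \<in> carrier_vec n"
        using X fgh l by auto
      then show "dim_vec (f l + g l + h l) = dim_vec (0\<^sub>v n)" by auto
      fix i assume "i < dim_vec (0\<^sub>v n :: F3 vec)"
      then have i: "i < n" by simp
      have "(glue n M f + glue n M g + glue n M h) $ (l * n + i) = 0"
        using sum glue_index(1)[OF i l] by simp
      moreover have "dim_vec (glue n M h) = n * M" "dim_vec (glue n M g) = n * M"
        by (simp_all add: glue_def)
      ultimately have "f l $ i + g l $ i + h l $ i = 0"
        by (simp add: glue_index[OF i l])
      then show "(f l + g l + h l) $ i = 0\<^sub>v n $ i"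
        using i dims by (simp add: add.assoc)
    qed
    have block': "g l + h l + f l = 0\<^sub>v n" if l: "l < M" for l
    proof -
      have dims: "f l \<in> carrier_vec n" "g l \<in> carrier_vec n" "h l \<in> carrier_vec n"
        using X fgh l by auto
      then have "g l + h l + f l = f l + (g l + h l)"
        by (intro comm_add_vec) auto
      also have "\<dots> = f l + g l + h l"
        using dims by (simp add: assoc_add_vec)
      finally show ?thesis
        using block[OF l] by simp
    qed
    show ?thesis
      using cap[OF fgh(1,2,3) block] cap[OF fgh(2,3,1) block'] by simp
  qed
  show ?thesis
    unfolding cap_set_def
  proof (intro conjI ballI impI)
    show "glue n M ` X \<subseteq> carrier_vec (n * M)"
      by (auto simp: glue_def)
  next
    fix x y z
    assume "x \<in> glue n M ` X" "y \<in> glue n M ` X" "z \<in> glue n M ` X"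
      and sum: "x + y + z = 0\<^sub>v (n * M)"
    then obtain f g h where "f \<in> X" "g \<in> X" "h \<in> X"
      and "x = glue n M f" "y = glue n M g" "z = glue n M h"
      by blast
    with sum collapse[of f g h] show "x = y" "y = z"
      by simp_all
  qed
qed

section \<open>Words with exactly one hole\<close>

text \<open>Words of length \<open>M\<close> over \<open>A\<close>, except that exactly one letter is replaced by the hole \<open>p\<close>; the
  intended \<open>p\<close> lies outside \<open>A\<close>.  A word is extensional, that is, undefined beyond its length.\<close>

definition one_hole_words :: "nat \<Rightarrow> 'a \<Rightarrow> 'a set \<Rightarrow> (nat \<Rightarrow> 'a) set" where
  "one_hole_words M p A = (\<Union>i<M. PiE {..<M} (\<lambda>j. if j = i then {p} else A))"

lemma one_hole_wordsE:
  assumes "f \<in> one_hole_words M p A"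
  obtains i where "i < M" "f i = p" "\<And>l. l < M \<Longrightarrow> l \<noteq> i \<Longrightarrow> f l \<in> A"
    "f \<in> extensional {..<M}"
proof -
  obtain i where i: "i < M" and f: "f \<in> PiE {..<M} (\<lambda>j. if j = i then {p} else A)"
    using assms unfolding one_hole_words_def by blast
  show ?thesis
  proof (rule that[OF i])
    show "f i = p"
      using PiE_mem[OF f, of i] i by simp
    show "f l \<in> A" if "l < M" "l \<noteq> i" for l
      using PiE_mem[OF f, of l] that by simp
    show "f \<in> extensional {..<M}"
      using f by (simp add: PiE_iff)
  qed
qed

lemma
  assumes "finite A" "p \<notin> A"
  shows finite_one_hole_words: "finite (one_hole_words M p A)"
    and card_one_hole_words: "card (one_hole_words M p A) = M * card A ^ (M - 1)"
proof -
  let ?P = "\<lambda>i. PiE {..<M} (\<lambda>j. if j = i then {p} else A)"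
  have fin: "finite (?P i)" for i
    using assms by (intro finite_PiE) auto
  show "finite (one_hole_words M p A)"
    unfolding one_hole_words_def using fin by blast
  have "card (one_hole_words M p A) = (\<Sum>i<M. card (?P i))"
    unfolding one_hole_words_def
  proof (rule card_UN_disjoint)
    show "\<forall>i\<in>{..<M}. \<forall>j\<in>{..<M}. i \<noteq> j \<longrightarrow> ?P i \<inter> ?P j = {}"
    proof (intro ballI impI)
      fix i j assume ij: "i \<in> {..<M}" "j \<in> {..<M}" "i \<noteq> j"
      have False if f: "f \<in> ?P i" "f \<in> ?P j" for f
        using PiE_mem[OF f(1), of i] PiE_mem[OF f(2), of i] ij assms by auto
      then show "?P i \<inter> ?P j = {}" by blast
    qed
  qed (use fin in auto)
  also have "\<dots> = (\<Sum>i<M. card A ^ (M - 1))"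
  proof (rule sum.cong[OF refl])
    fix i assume i: "i \<in> {..<M}"
    have "card (?P i) = (\<Prod>j<M. if j = i then 1 else card A)"
      by (subst card_PiE) (auto intro!: prod.cong)
    also have "\<dots> = (\<Prod>j\<in>{..<M} - {i}. card A)"
      by (subst prod.remove[OF _ i]) (auto intro!: prod.cong)
    also have "\<dots> = card A ^ (M - 1)"
      using i by simp
    finally show "card (?P i) = card A ^ (M - 1)" .
  qed
  finally show "card (one_hole_words M p A) = M * card A ^ (M - 1)"
    by simp
qed

section \<open>Linear hashing\<close>

text \<open>Coordinate \<open>t \<le> d\<close> of the weight vector of position \<open>l < 2 ^ d\<close>: the binary digits of \<open>l\<close> as
  coordinates \<open>0, \<dots>, d - 1\<close>, and the constant \<open>1\<close> as coordinate \<open>d\<close>.\<close>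

definition weight :: "nat \<Rightarrow> nat \<Rightarrow> nat \<Rightarrow> F3" where
  "weight d t l = (if t < d then of_bool (bit l t) else 1)"

text \<open>The constant coordinate forces the three coefficients to be equal, since nonzero elements with
  zero sum are equal.  The other coordinates then say that the digit vectors have zero sum modulo
  three, so that in each place all three digits agree.\<close>

lemma weight_independent:
  fixes \<alpha> \<beta> \<gamma> :: F3
  assumes "i < 2 ^ d" "j < 2 ^ d" "i \<noteq> j" and nz: "\<alpha> \<noteq> 0" "\<beta> \<noteq> 0" "\<gamma> \<noteq> 0"
    and rel: "\<And>t. t \<le> d \<Longrightarrow> \<alpha> * weight d t i + \<beta> * weight d t j + \<gamma> * weight d t k = 0"
  shows False
proof -
  have "\<alpha> + \<beta> + \<gamma> = 0"
    using rel[of d] by (simp add: weight_def)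
  then have eq: "\<alpha> = \<beta>" "\<beta> = \<gamma>"
    using F3_sum_zero_nonzero nz by blast+
  have "bit i t = bit j t" for t
  proof (cases "t < d")
    case True
    have "\<gamma> * (weight d t i + weight d t j + weight d t k) = 0"
      using rel[of t] True eq by (simp add: distrib_left)
    then have "weight d t i + weight d t j + weight d t k = 0"
      using nz F3_mult_eq_0_iff by blast
    then show ?thesis
      using True F3_of_bool_sum_zero by (simp add: weight_def)
  next
    case False
    have "take_bit d i = i" "take_bit d j = j"
      using assms by (simp_all add: take_bit_nat_eq_self)
    then show ?thesis
      using False by (metis bit_take_bit_iff)
  qed
  then have "i = j"
    by (simp add: bit_eq_iff)
  then show False
    using assms by simp
qed

text \<open>Coordinate \<open>t\<close> of the hash of a word of length \<open>2 ^ d\<close>.\<close>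

definition hash :: "('a \<Rightarrow> F3) \<Rightarrow> nat \<Rightarrow> nat \<Rightarrow> (nat \<Rightarrow> 'a) \<Rightarrow> F3" where
  "hash \<phi> d t f = (\<Sum>l<2 ^ d. \<phi> (f l) * weight d t l)"

text \<open>Forbidden values \<open>s t\<close> for the functions \<open>h t\<close> can be chosen one after the other such that each
  choice keeps at least two thirds of the elements left so far: the values \<open>0\<close>, \<open>1\<close> and \<open>2\<close> split
  these into three classes, and the smallest class is dropped.\<close>

lemma popular_shift:
  fixes h :: "nat \<Rightarrow> 'b \<Rightarrow> F3"
  assumes X: "finite X"
  shows "\<exists>s. 2 ^ r * card X \<le> 3 ^ r * card {f \<in> X. \<forall>t<r. h t f \<noteq> s t}"
proof (induction r)
  case 0
  then show ?case by simp
next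
  case (Suc r)
  then obtain s where s: "2 ^ r * card X \<le> 3 ^ r * card {f \<in> X. \<forall>t<r. h t f \<noteq> s t}"
    by blast
  define Y where "Y = {f \<in> X. \<forall>t<r. h t f \<noteq> s t}"
  have fin: "finite Y"
    using X by (simp add: Y_def)
  let ?N = "\<lambda>a. card {f \<in> Y. h r f \<noteq> a}"
  have "\<exists>a. 2 * card Y \<le> 3 * ?N a"
  proof -
    have cardN: "?N a + card {f \<in> Y. h r f = a} = card Y" for a
    proof -
      have "?N a + card {f \<in> Y. h r f = a} = card ({f \<in> Y. h r f \<noteq> a} \<union> {f \<in> Y. h r f = a})"
        using fin by (intro card_Un_disjoint[symmetric]) auto
      also have "{f \<in> Y. h r f \<noteq> a} \<union> {f \<in> Y. h r f = a} = Y"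
        by blast
      finally show ?thesis .
    qed
    have "Y = {f \<in> Y. h r f = 0} \<union> ({f \<in> Y. h r f = 1} \<union> {f \<in> Y. h r f = 2})"
      using F3_cases by blast
    moreover have "card ({f \<in> Y. h r f = 0} \<union> ({f \<in> Y. h r f = 1} \<union> {f \<in> Y. h r f = 2}))
      = card {f \<in> Y. h r f = 0} + (card {f \<in> Y. h r f = 1} + card {f \<in> Y. h r f = 2})"
      using fin by (subst card_Un_disjoint; (subst card_Un_disjoint)?) auto
    ultimately have "card Y =
        card {f \<in> Y. h r f = 0} + (card {f \<in> Y. h r f = 1} + card {f \<in> Y. h r f = 2})"
      by simp
    then have "2 * card Y \<le> 3 * ?N 0 \<or> 2 * card Y \<le> 3 * ?N 1 \<or> 2 * card Y \<le> 3 * ?N 2"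
      using cardN[of 0] cardN[of 1] cardN[of 2] by linarith
    then show ?thesis by blast
  qed
  then obtain a where a: "2 * card Y \<le> 3 * ?N a" by blast
  have "2 ^ Suc r * card X \<le> 2 * (3 ^ r * card Y)"
    using s by (simp add: Y_def)
  also have "\<dots> \<le> 3 ^ Suc r * ?N a"
    using mult_le_mono2[OF a, of "3 ^ r"] by (simp add: ac_simps)
  also have "{f \<in> Y. h r f \<noteq> a} = {f \<in> X. \<forall>t<Suc r. h t f \<noteq> (s(r := a)) t}"
    by (auto simp: Y_def less_Suc_eq)
  finally have "2 ^ Suc r * card X
      \<le> 3 ^ Suc r * card {f \<in> X. \<forall>t<Suc r. h t f \<noteq> (s(r := a)) t}" .
  then show ?case
    by (intro exI[of _ "s(r := a)"])
qed

section \<open>Zero-sum triples of hashed words\<close>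

text \<open>Among one-hole words whose hashes avoid the values \<open>s\<close>, zero-sum triples are trivial.\<close>

lemma zero_sum_words_collapse:
  assumes cap: "cap_set n A" and p: "p \<in> carrier_vec n" "p \<notin> A"
    and \<phi>_p: "\<phi> p = 0"
    and \<phi>_nz: "\<And>u. u \<in> carrier_vec n \<Longrightarrow> u \<noteq> p \<Longrightarrow> \<phi> u \<noteq> 0"
    and \<phi>_odd: "\<And>u v. u \<in> carrier_vec n \<Longrightarrow> v \<in> carrier_vec n \<Longrightarrow> p + u + v = 0\<^sub>v n \<Longrightarrow> \<phi> v = - \<phi> u"
    and W: "f \<in> one_hole_words (2 ^ d) p A" "g \<in> one_hole_words (2 ^ d) p A"
      "h \<in> one_hole_words (2 ^ d) p A"
    and avoid: "\<And>t. t \<le> d \<Longrightarrow> hash \<phi> d t f \<noteq> s t" "\<And>t. t \<le> d \<Longrightarrow> hash \<phi> d t g \<noteq> s t"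
      "\<And>t. t \<le> d \<Longrightarrow> hash \<phi> d t h \<noteq> s t"
    and sum: "\<And>l. l < 2 ^ d \<Longrightarrow> f l + g l + h l = 0\<^sub>v n"
  shows "f = g"
proof -
  let ?M = "2 ^ d :: nat"
  obtain i where i: "i < ?M" "f i = p" "\<And>l. l < ?M \<Longrightarrow> l \<noteq> i \<Longrightarrow> f l \<in> A" "f \<in> extensional {..<?M}"
    using one_hole_wordsE[OF W(1)] by metis
  obtain j where j: "j < ?M" "g j = p" "\<And>l. l < ?M \<Longrightarrow> l \<noteq> j \<Longrightarrow> g l \<in> A" "g \<in> extensional {..<?M}"
    using one_hole_wordsE[OF W(2)] by metis
  obtain k where k: "k < ?M" "h k = p" "\<And>l. l < ?M \<Longrightarrow> l \<noteq> k \<Longrightarrow> h l \<in> A" "h \<in> extensional {..<?M}"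
    using one_hole_wordsE[OF W(3)] by metis
  have A: "A \<subseteq> carrier_vec n"
    using cap by (simp add: cap_set_def)
  have carr: "f l \<in> carrier_vec n" "g l \<in> carrier_vec n" "h l \<in> carrier_vec n" if "l < ?M" for l
    using i j k that A p(1) by (metis subsetD)+
  have cap': "x = y \<and> y = z" if "x \<in> A" "y \<in> A" "z \<in> A" "x + y + z = 0\<^sub>v n" for x y z
    using cap that by (simp add: cap_set_def)
  have index_sum: "f l $ e + g l $ e + h l $ e = 0" if "l < ?M" "e < n" for l e
  proof -
    have "(f l + g l + h l) $ e = 0"
      using sum[OF that(1)] that by simp
    then show ?thesis
      using carr[OF that(1)] that by (simp add: add.assoc)
  qed
  have sum_gfh: "g l + f l + h l = 0\<^sub>v n" and sum_hfg: "h l + f l + g l = 0\<^sub>v n"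
    and sum_ghf: "g l + h l + f l = 0\<^sub>v n" and sum_fhg: "f l + h l + g l = 0\<^sub>v n" if "l < ?M" for l
    using carr[OF that] index_sum[OF that] by (auto intro!: eq_vecI simp: add_ac)
  \<comment> \<open>Two of the three words cannot share a hole that the third does not have.\<close>
  have two: "f l = p \<Longrightarrow> g l = p \<Longrightarrow> h l = p" "g l = p \<Longrightarrow> h l = p \<Longrightarrow> f l = p"
    "f l = p \<Longrightarrow> h l = p \<Longrightarrow> g l = p" if l: "l < ?M" for l
  proof -
    show "h l = p" if "f l = p" "g l = p"
      using zero_sum_pair[OF p(1) carr(3)[OF l]] sum[OF l] that by simp
    show "f l = p" if "g l = p" "h l = p"
      using zero_sum_pair[OF p(1) carr(1)[OF l]] sum_ghf[OF l] that by simp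
    show "g l = p" if "f l = p" "h l = p"
      using zero_sum_pair[OF p(1) carr(2)[OF l]] sum_fhg[OF l] that by simp
  qed
  have holes: "f l = p \<longleftrightarrow> l = i" "g l = p \<longleftrightarrow> l = j" "h l = p \<longleftrightarrow> l = k" if l: "l < ?M" for l
    using i j k l p(2) by metis+
  have "k = i" if "i = j"
    using two(1)[OF i(1)] holes[OF i(1)] that by simp
  moreover have "i = j" if "j = k"
    using two(2)[OF j(1)] holes[OF j(1)] that by simp
  moreover have "j = i" if "i = k"
    using two(3)[OF i(1)] holes[OF i(1)] that by simp
  ultimately consider (same) "i = j" "j = k" | (distinct) "i \<noteq> j" "j \<noteq> k" "i \<noteq> k"
    by metis
  then show ?thesis
  proof cases
    case same
    show ?thesis
    proof (rule extensionalityI[OF i(4) j(4)])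
      fix l assume "l \<in> {..<?M}"
      then have l: "l < ?M" by simp
      show "f l = g l"
      proof (cases "l = i")
        case False
        then have "f l \<in> A" "g l \<in> A" "h l \<in> A"
          using i(3)[OF l] j(3)[OF l] k(3)[OF l] same by simp_all
        then show ?thesis
          using cap' sum[OF l] by metis
      qed (use i(2) j(2) same in simp)
    qed
  next
    case distinct
    have off: "f l = g l" if "l < ?M" "l \<noteq> i" "l \<noteq> j" "l \<noteq> k" for l
      using cap'[OF i(3) j(3) k(3) sum] that by simp
    \<comment> \<open>The coefficients of the dependency between the weights: nonzero exactly at the holes.\<close>
    define \<delta> where "\<delta> l = \<phi> (f l) - \<phi> (g l)" for l
    have hash_eq: "hash \<phi> d t f = hash \<phi> d t g" if t: "t \<le> d" for t
    proof -
      have "\<phi> (f l) + \<phi> (g l) + \<phi> (h l) = 0" if l: "l < ?M" for l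
      proof -
        consider "l = i" | "l = j" | "l = k" | "l \<noteq> i" "l \<noteq> j" "l \<noteq> k" by blast
        then show ?thesis
        proof cases
          case 1
          then show ?thesis
            using \<phi>_odd[of "g l" "h l"] sum[OF l] carr[OF l] \<phi>_p i(2) by simp
        next
          case 2
          then show ?thesis
            using \<phi>_odd[of "f l" "h l"] sum_gfh[OF l] carr[OF l] \<phi>_p j(2) by simp
        next
          case 3
          then show ?thesis
            using \<phi>_odd[of "f l" "g l"] sum_hfg[OF l] carr[OF l] \<phi>_p k(2) by simp
        next
          case 4
          then have "f l = g l" "g l = h l"
            using cap'[OF i(3) j(3) k(3) sum, OF l _ l _ l _ l] by simp_all
          then show ?thesis
            using F3_three_times by metis
        qed
      qed
      then have "(\<Sum>l<?M. (\<phi> (f l) + \<phi> (g l) + \<phi> (h l)) * weight d t l) = 0"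
        by simp
      then have "hash \<phi> d t f + hash \<phi> d t g + hash \<phi> d t h = 0"
        unfolding hash_def by (simp add: sum.distrib distrib_right)
      then show ?thesis
        using F3_sum_zero_avoiding(1) avoid[OF t] by blast
    qed
    have rel: "\<delta> i * weight d t i + \<delta> j * weight d t j + \<delta> k * weight d t k = 0" if "t \<le> d" for t
    proof -
      have "0 = (\<Sum>l<?M. \<delta> l * weight d t l)"
        using hash_eq[OF that] unfolding hash_def \<delta>_def by (simp add: left_diff_distrib sum_subtractf)
      also have "\<dots> = (\<Sum>l\<in>{i, j, k}. \<delta> l * weight d t l)"
        using i(1) j(1) k(1) off by (intro sum.mono_neutral_right) (auto simp: \<delta>_def)
      finally show ?thesis
        using distinct by (simp add: add.assoc)
    qed
    have ne: "g i \<noteq> p" "f j \<noteq> p" "f k \<noteq> p"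
      using distinct holes(2)[OF i(1)] holes(1)[OF j(1)] holes(1)[OF k(1)] by simp_all
    have "\<delta> i \<noteq> 0" "\<delta> j \<noteq> 0"
      using \<phi>_nz[OF _ ne(1)] \<phi>_nz[OF _ ne(2)] carr(2)[OF i(1)] carr(1)[OF j(1)] i(2) j(2) \<phi>_p by (simp_all add: \<delta>_def)
    moreover have "\<delta> k \<noteq> 0"
    proof -
      have "\<phi> (g k) = - \<phi> (f k)"
        using \<phi>_odd[of "f k" "g k"] sum_hfg[OF k(1)] carr[OF k(1)] k(2) by simp
      moreover have "\<phi> (f k) \<noteq> 0"
        using \<phi>_nz[OF _ ne(3)] carr(1)[OF k(1)] by simp
      ultimately show ?thesis
        by (cases "\<phi> (f k)" rule: F3_cases) (simp_all add: \<delta>_def)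
    qed
    ultimately have False
      using weight_independent[OF i(1) j(1) distinct(1) _ _ _ rel] by blast
    then show ?thesis ..
  qed
qed

section \<open>Beating the power of a cap set\<close>

lemma cap_set_beats_power:
  assumes n: "n \<ge> 1" and cap: "cap_set n A" and pos: "card A > 0"
  obtains M B where "M \<ge> 2" "cap_set (n * M) B" "card B > card A ^ M"
proof -
  have fin: "finite A"
    using pos card_gt_0_iff by blast
  obtain p where p: "p \<in> carrier_vec n" "p \<notin> A"
    using cap_set_misses_point[OF n cap] .
  obtain \<phi> :: "F3 vec \<Rightarrow> F3" where \<phi>: "\<phi> p = 0"
    "\<And>u. u \<in> carrier_vec n \<Longrightarrow> u \<noteq> p \<Longrightarrow> \<phi> u \<noteq> 0"
    "\<And>u v. u \<in> carrier_vec n \<Longrightarrow> v \<in> carrier_vec n \<Longrightarrow> p + u + v = 0\<^sub>v n \<Longrightarrow> \<phi> v = - \<phi> u"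
    using odd_function_around_point[OF p(1)] by blast
  \<comment> \<open>Chosen such that \<open>2 ^ d * (2 / 3) ^ (d + 1)\<close>, the gain from the position of the hole times the
    loss from hashing, exceeds \<open>card A\<close>.\<close>
  obtain d where "3 * card A / 2 < (4 / 3 :: real) ^ d"
    using real_arch_pow[of "4 / 3" "3 * card A / 2"] by auto
  then have "real (3 ^ Suc d * card A) < real (2 ^ Suc d * 2 ^ d)"
    by (simp add: field_simps flip: power_mult_distrib)
  then have d: "3 ^ Suc d * card A < 2 ^ Suc d * 2 ^ d"
    by (simp only: of_nat_less_iff)
  have "d \<noteq> 0"
  proof
    assume "d = 0"
    then show False using d pos by simp
  qed
  define M :: nat where "M = 2 ^ d"
  have M: "M \<ge> 2"
    using \<open>d \<noteq> 0\<close> self_le_power[of 2 d] by (simp add: M_def)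
  define W where "W = one_hole_words M p A"
  have finW: "finite W" and cardW: "card W = M * card A ^ (M - 1)"
    using finite_one_hole_words[OF fin p(2)] card_one_hole_words[OF fin p(2)] by (simp_all add: W_def)
  obtain s where s: "2 ^ Suc d * card W \<le> 3 ^ Suc d * card {f \<in> W. \<forall>t<Suc d. hash \<phi> d t f \<noteq> s t}"
    using popular_shift[OF finW, of "Suc d" "hash \<phi> d"] by blast
  define X where "X = {f \<in> W. \<forall>t<Suc d. hash \<phi> d t f \<noteq> s t}"
  have XPi: "X \<subseteq> PiE {..<M} (\<lambda>_. carrier_vec n)"
  proof
    fix f assume "f \<in> X"
    then have "f \<in> one_hole_words M p A"
      by (simp add: X_def W_def)
    then obtain i where "f i = p" "\<And>l. l < M \<Longrightarrow> l \<noteq> i \<Longrightarrow> f l \<in> A" "f \<in> extensional {..<M}"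
      by (metis one_hole_wordsE)
    then show "f \<in> PiE {..<M} (\<lambda>_. carrier_vec n)"
      using cap p(1) unfolding cap_set_def PiE_iff by (metis lessThan_iff subsetD)
  qed
  have "cap_set (n * M) (glue n M ` X)"
  proof (rule cap_set_glue[OF XPi])
    fix f g h assume "f \<in> X" "g \<in> X" "h \<in> X" and sum: "\<And>l. l < M \<Longrightarrow> f l + g l + h l = 0\<^sub>v n"
    then show "f = g"
      by (intro zero_sum_words_collapse[where p = p and \<phi> = \<phi> and d = d and h = h and s = s, OF cap p \<phi>])
        (auto simp: X_def W_def M_def)
  qed
  moreover have "card (glue n M ` X) > card A ^ M"
  proof -
    have "3 ^ Suc d * card A ^ M = (3 ^ Suc d * card A) * card A ^ (M - 1)"
      using M by (simp add: mult.assoc flip: power_Suc)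
    also have "\<dots> < (2 ^ Suc d * 2 ^ d) * card A ^ (M - 1)"
      using d pos by (intro mult_strict_right_mono) simp_all
    also have "\<dots> = 2 ^ Suc d * card W"
      by (simp add: cardW M_def)
    also have "\<dots> \<le> 3 ^ Suc d * card X"
      using s by (simp add: X_def)
    finally have "card A ^ M < card X"
      by (simp del: power_Suc)
    then show ?thesis
      using card_image[OF inj_on_subset[OF inj_on_glue XPi]] by simp
  qed
  ultimately show ?thesis
    using that M by blast
qed

theorem corollary1p2:
  fixes n :: nat and A :: "F3 vec set" and c :: real
  assumes "n \<ge> 1"
    and "cap_set n A"
    and "c \<ge> 0"
    and "real (card A) = c ^ n"
  shows "\<exists>m > n. \<exists>B. cap_set m B \<and> real (card B) > c ^ m"
proof (cases "card A = 0")
  \<comment> \<open>Here \<open>A\<close> is empty, and so are its powers; a single point does better.\<close>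
  case True
  then have "c = 0"
    using assms(4) by simp
  moreover have "cap_set (Suc n) {0\<^sub>v (Suc n)}"
    by (auto simp: cap_set_def)
  ultimately show ?thesis
    by (intro exI[of _ "Suc n"] conjI exI[of _ "{0\<^sub>v (Suc n)}"]) auto
next
  case False
  then obtain M B where M: "M \<ge> 2" and B: "cap_set (n * M) B" "card B > card A ^ M"
    using cap_set_beats_power[OF assms(1,2)] by blast
  have "c ^ (n * M) = real (card A ^ M)"
    using assms(4) by (simp add: power_mult)
  then have "real (card B) > c ^ (n * M)"
    using B(2) by (simp only: of_nat_less_iff)
  moreover have "n * M > n"
    using assms(1) M by simp
  ultimately show ?thesis
    using B(1) by blast
qed

end
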